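(* Let $g(z)=az^4+bz^3+cz^2+dz+e$ be a quartic polynomial with real coefficients and $a>0$, $e>0$. Let $$\alpha=b\,a^{-3/4}e^{-1/4},\quad \beta=c\,a^{-1/2}e^{-1/2},\quad \gamma=d\,a^{-1/4}e^{-3/4},$$ $$f(t)=t^4+\alpha t^3+\beta t^2+\gamma t+1,$$ $$\Delta(f)=4[\beta^2-3\alpha\gamma+12]^3-[72\beta+9\alpha\beta\gamma-2\beta^3-27\alpha^2-27\gamma^2]^2.$$ Then $f(t)\ge 0$ for all real $t$ if and only if $\Delta(f)\ge 0$, $|\alpha-\gamma|\le 4\sqrt{\beta+2}$, and either (i) $-2\le\beta\le 6$, or (ii) $\beta>6$ and $|\alpha+\gamma|\le 4\sqrt{\beta-2}$. Furthermore, $f(t)>0$ for all real $t$ if and only if at least one of the following holds: (A) $\Delta(f)=0$, $\alpha=\gamma$ and $\alpha^2+8=4\beta<24$; (B) $\Delta(f)>0$, $|\alpha-\gamma|\le 4\sqrt{\beta+2}$, and either (i) $-2\le\beta\le 6$, or (ii) $\beta>6$ and $|\alpha+\gamma|\le 4\sqrt{\beta-2}$.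
   Context: $\Delta(f)$, as given by the displayed formula, is (up to a positive constant factor) the discriminant of $f$. The conditions involving $\sqrt{\beta+2}$ are only considered together with (i) or (ii), so that $\beta\ge -2$. *)

theory Defs
  imports Complex_Main "HOL-Computational_Algebra.Polynomial"
begin

(* \<Delta>(f) for f(t) = t^4 + \<alpha> t^3 + \<beta> t^2 + \<gamma> t + 1, as a function of the three coefficients.
   It equals 27 times the discriminant of f. *)
definition quartic_Delta :: "real \<Rightarrow> real \<Rightarrow> real \<Rightarrow> real" where
  "quartic_Delta \<alpha> \<beta> \<gamma> =
     4 * (\<beta>^2 - 3 * \<alpha> * \<gamma> + 12)^3
     - (72 * \<beta> + 9 * \<alpha> * \<beta> * \<gamma> - 2 * \<beta>^3 - 27 * \<alpha>^2 - 27 * \<gamma>^2)^2"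

end

theory Submission
  imports Defs "HOL-Computational_Algebra.Fundamental_Theorem_Algebra"
begin

text \<open>
  Write f as a product of two real quadratics t^2 + p t + q and t^2 + r t + s with q s = 1.
  Then f is nonnegative iff either both quadratics have nonpositive discriminant or they coincide,
  and \<Delta>(f) is 27 times the product of the two discriminants and the squared resultant.
  If q > 0, put q = k^2, s = l^2, p = k P, r = l R with k l = 1: the quadratics have real roots
  iff |P| \<ge> 2 and |R| \<ge> 2 respectively, while \<alpha> - \<gamma> = (k - l)(P - R) and
  \<alpha> + \<gamma> = (k + l)(P + R), so the root conditions reduce to elementary inequalities
  between k - l, P and R. The case q < 0 is similar.
\<close>

section \<open>Factoring a real quartic into two real quadratics\<close>

text \<open>The real quadratic with roots \<open>z\<close> and its conjugate divides the quartic: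
  the remainder is linear with real coefficients and vanishes at a nonreal point, hence is
  zero.\<close>

lemma quartic_factor_of_nonreal_root:
  fixes a b c d :: real and z :: complex
  assumes root: "z ^ 4 + of_real a * z ^ 3 + of_real b * z\<^sup>2 + of_real c * z + of_real d = 0"
    and im: "Im z \<noteq> 0"
  shows "\<exists>p q r s. a = p + r \<and> b = q + s + p * r \<and> c = p * s + r * q \<and> d = q * s"
proof -
  define p q where "p = - 2 * Re z" and "q = (Re z)\<^sup>2 + (Im z)\<^sup>2"
  define r where "r = a - p"
  define s where "s = b - q - p * r"
  have quad: "z\<^sup>2 + of_real p * z + of_real q = 0"
    by (simp add: complex_eq_iff p_def q_def power2_eq_square algebra_simps)
  have "z ^ 4 + of_real a * z ^ 3 + of_real b * z\<^sup>2 + of_real c * z + of_real d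
      = (z\<^sup>2 + of_real p * z + of_real q) * (z\<^sup>2 + of_real r * z + of_real s)
        + of_real (c - p * s - r * q) * z + of_real (d - q * s)"
    by (simp add: r_def s_def algebra_simps power2_eq_square power3_eq_cube power4_eq_xxxx)
  then have rem: "of_real (c - p * s - r * q) * z + of_real (d - q * s) = 0"
    using root quad by simp
  have "(c - p * s - r * q) * Im z = 0"
    using arg_cong[OF rem, of Im] by simp
  then have c: "c - p * s - r * q = 0"
    using im by simp
  have "d - q * s = 0"
    using arg_cong[OF rem, of Re] c by simp
  then show ?thesis
    using c by (intro exI[of _ p] exI[of _ q] exI[of _ r] exI[of _ s])
      (auto simp: r_def s_def algebra_simps)
qed

text \<open>If the root found is real, it is split off; a nonreal root of the cubic cofactor is also
  a root of the quartic, and a real one yields the first factor together with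
  \<open>x\<close>.\<close>

lemma quartic_factor:
  fixes a b c d :: real
  shows "\<exists>p q r s. a = p + r \<and> b = q + s + p * r \<and> c = p * s + r * q \<and> d = q * s"
proof -
  have "\<not> constant (poly [:of_real d, of_real c, of_real b, of_real a, 1 :: complex:])"
    by (simp add: constant_degree)
  then obtain z :: complex where "poly [:of_real d, of_real c, of_real b, of_real a, 1:] z = 0"
    using fundamental_theorem_of_algebra by blast
  then have z: "z ^ 4 + of_real a * z ^ 3 + of_real b * z\<^sup>2 + of_real c * z + of_real d = 0"
    by (simp add: algebra_simps power2_eq_square power3_eq_cube power4_eq_xxxx)
  show ?thesis
  proof (cases "Im z = 0")
    case False
    then show ?thesis
      using z quartic_factor_of_nonreal_root by blast
  next
    case True
    then obtain x where x: "z = of_real x"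
      by (metis complex_is_Real_iff Reals_cases)
    \<comment> \<open>Synthetic division by t - x, with quotient t^3 + A t^2 + B t + C.\<close>
    define A B C where "A = a + x" and "B = b + A * x" and "C = c + B * x"
    have d: "d = - x * C"
    proof -
      have "complex_of_real (x ^ 4 + a * x ^ 3 + b * x\<^sup>2 + c * x + d) = 0"
        using z by (simp add: x)
      then have "x ^ 4 + a * x ^ 3 + b * x\<^sup>2 + c * x + d = 0"
        by (simp only: of_real_eq_0_iff)
      then show ?thesis
        by (simp add: A_def B_def C_def algebra_simps power2_eq_square power3_eq_cube
            power4_eq_xxxx)
    qed
    have "\<not> constant (poly [:of_real C, of_real B, of_real A, 1 :: complex:])"
      by (simp add: constant_degree)
    then obtain w :: complex where "poly [:of_real C, of_real B, of_real A, 1:] w = 0"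
      using fundamental_theorem_of_algebra by blast
    then have w: "w ^ 3 + of_real A * w\<^sup>2 + of_real B * w + of_real C = 0"
      by (simp add: algebra_simps power2_eq_square power3_eq_cube)
    show ?thesis
    proof (cases "Im w = 0")
      case False
      have "w ^ 4 + of_real a * w ^ 3 + of_real b * w\<^sup>2 + of_real c * w + of_real d
          = (w - of_real x) * (w ^ 3 + of_real A * w\<^sup>2 + of_real B * w + of_real C)"
        by (simp add: d) (simp add: A_def B_def C_def algebra_simps power2_eq_square
            power3_eq_cube power4_eq_xxxx)
      then show ?thesis
        using w False quartic_factor_of_nonreal_root by (metis mult_zero_right)
    next
      case True
      then obtain y where y: "w = of_real y"
        by (metis complex_is_Real_iff Reals_cases)
      have "complex_of_real (y ^ 3 + A * y\<^sup>2 + B * y + C) = 0"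
        using w by (simp add: y)
      then have C: "C = - (y ^ 3 + A * y\<^sup>2 + B * y)"
        by (simp only: of_real_eq_0_iff)
      have c: "c = C - B * x" and b: "b = B - A * x" and a: "a = A - x"
        by (simp_all add: A_def B_def C_def)
      show ?thesis
        \<comment> \<open>The first factor is (t - x)(t - y), the second the quotient of the cubic
          by t - y.\<close>
        by (intro exI[of _ "- x - y"] exI[of _ "x * y"] exI[of _ "A + y"]
            exI[of _ "B + (A + y) * y"])
          (simp add: a b c d C algebra_simps power2_eq_square power3_eq_cube)
    qed
  qed
qed

section \<open>Signs of quadratics and of their products\<close>

lemma quadratic_nonneg:
  fixes p q t :: real
  assumes "p\<^sup>2 \<le> 4 * q"
  shows "t\<^sup>2 + p * t + q \<ge> 0"
proof -
  have "4 * (t\<^sup>2 + p * t + q) = (2 * t + p)\<^sup>2 + (4 * q - p\<^sup>2)"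
    by (simp add: power2_eq_square algebra_simps)
  also have "\<dots> \<ge> 0"
    using assms by (intro add_nonneg_nonneg) auto
  finally show ?thesis
    by simp
qed

lemma quadratic_pos:
  fixes p q t :: real
  assumes "p\<^sup>2 < 4 * q"
  shows "t\<^sup>2 + p * t + q > 0"
proof -
  have "4 * (t\<^sup>2 + p * t + q) = (2 * t + p)\<^sup>2 + (4 * q - p\<^sup>2)"
    by (simp add: power2_eq_square algebra_simps)
  also have "\<dots> > 0"
    using assms by (intro add_nonneg_pos) auto
  finally show ?thesis
    by simp
qed

text \<open>The sign \<open>\<sigma>\<close> selects one of the two roots, so that a single
  computation serves both.\<close>

lemma quadratic_root:
  fixes p q \<sigma> :: real
  assumes "4 * q \<le> p\<^sup>2" and "\<sigma>\<^sup>2 = 1"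
  defines "x \<equiv> (\<sigma> * sqrt (p\<^sup>2 - 4 * q) - p) / 2"
  shows "x\<^sup>2 + p * x + q = 0"
proof -
  have "4 * (x\<^sup>2 + p * x + q) = \<sigma>\<^sup>2 * (sqrt (p\<^sup>2 - 4 * q))\<^sup>2 - (p\<^sup>2 - 4 * q)"
    by (simp add: x_def power2_eq_square field_simps)
  then show ?thesis
    using assms by simp
qed

text \<open>Both roots of the first factor are minima of the product, so its derivative vanishes there
  and they are roots of the second factor as well.\<close>
lemma quadratic_product_nonneg_imp_eq:
  fixes p q r s :: real
  assumes nonneg: "\<And>t. (t\<^sup>2 + p * t + q) * (t\<^sup>2 + r * t + s) \<ge> 0"
    and disc: "4 * q < p\<^sup>2"
  shows "p = r \<and> q = s"
proof -
  define w where "w = sqrt (p\<^sup>2 - 4 * q)"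
  have w: "w > 0"
    using disc by (simp add: w_def)
  have *: "(p - r) * x + (q - s) = 0" if "\<sigma>\<^sup>2 = 1" and x: "x = (\<sigma> * w - p) / 2" for x \<sigma>
  proof -
    have root: "x\<^sup>2 + p * x + q = 0"
      using quadratic_root[of q p \<sigma>] disc that(1) unfolding that(2) w_def by simp
    have "((\<lambda>t. (t\<^sup>2 + p * t + q) * (t\<^sup>2 + r * t + s)) has_field_derivative
        (2 * x + p) * (x\<^sup>2 + r * x + s) + (x\<^sup>2 + p * x + q) * (2 * x + r)) (at x)"
      by (auto intro!: derivative_eq_intros simp: algebra_simps power2_eq_square)
    from DERIV_local_min[OF this zero_less_one]
    have "(2 * x + p) * (x\<^sup>2 + r * x + s) + (x\<^sup>2 + p * x + q) * (2 * x + r) = 0"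
      using nonneg root by simp
    moreover have "2 * x + p = \<sigma> * w"
      using that(2) by simp
    then have "2 * x + p \<noteq> 0"
      using w that(1) by auto
    ultimately have "x\<^sup>2 + r * x + s = 0"
      using root by simp
    with root show ?thesis
      by (simp add: algebra_simps)
  qed
  have 1: "(p - r) * ((w - p) / 2) + (q - s) = 0"
    using *[OF _ refl, of 1] by simp
  have 2: "(p - r) * ((- w - p) / 2) + (q - s) = 0"
    using *[OF _ refl, of "- 1"] by simp
  \<comment> \<open>An affine function of slope \<open>p - r\<close> vanishes at two points at
    distance \<open>w > 0\<close>.\<close>
  have "(p - r) * w = ((p - r) * ((w - p) / 2) + (q - s)) - ((p - r) * ((- w - p) / 2) + (q - s))"
    by (simp add: field_simps)
  then have "(p - r) * w = 0"
    unfolding 1 2 by simp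
  then have "p = r"
    using w by simp
  with 1 show ?thesis
    by simp
qed

lemma quadratic_product_nonneg_iff:
  fixes p q r s :: real
  shows "(\<forall>t. (t\<^sup>2 + p * t + q) * (t\<^sup>2 + r * t + s) \<ge> 0) \<longleftrightarrow>
    (p\<^sup>2 \<le> 4 * q \<and> r\<^sup>2 \<le> 4 * s) \<or> (p = r \<and> q = s)"
proof
  assume nonneg: "\<forall>t. (t\<^sup>2 + p * t + q) * (t\<^sup>2 + r * t + s) \<ge> 0"
  then have "(t\<^sup>2 + r * t + s) * (t\<^sup>2 + p * t + q) \<ge> 0" for t
    by (metis mult.commute)
  then show "(p\<^sup>2 \<le> 4 * q \<and> r\<^sup>2 \<le> 4 * s) \<or> (p = r \<and> q = s)"
    using nonneg quadratic_product_nonneg_imp_eq[of p q r s]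
      quadratic_product_nonneg_imp_eq[of r s p q] by fastforce
qed (auto simp: quadratic_nonneg mult_nonneg_nonneg)

lemma quadratic_product_pos_iff:
  fixes p q r s :: real
  shows "(\<forall>t. (t\<^sup>2 + p * t + q) * (t\<^sup>2 + r * t + s) > 0) \<longleftrightarrow> p\<^sup>2 < 4 * q \<and> r\<^sup>2 < 4 * s"
proof
  assume pos: "\<forall>t. (t\<^sup>2 + p * t + q) * (t\<^sup>2 + r * t + s) > 0"
  show "p\<^sup>2 < 4 * q \<and> r\<^sup>2 < 4 * s"
    using pos quadratic_root[of q p 1] quadratic_root[of s r 1]
    by (metis less_irrefl mult_zero_left mult_zero_right not_less power_one)
qed (simp add: quadratic_pos)

section \<open>Resultant of the factors and \<Delta>\<close>

text \<open>For t^2 + p t + q and t^2 + r t + s this is the product of all four differences between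
  a root of one and a root of the other.\<close>

definition quadratic_resultant :: "real \<Rightarrow> real \<Rightarrow> real \<Rightarrow> real \<Rightarrow> real" where
  "quadratic_resultant p q r s = (q - s)\<^sup>2 + (p - r) * (p * s - r * q)"

lemma quadratic_resultant_commute: "quadratic_resultant p q r s = quadratic_resultant r s p q"
  by (simp add: quadratic_resultant_def power2_eq_square algebra_simps)

text \<open>A common nonreal root brings its conjugate along. In real terms, four times the
  resultant is a square plus a positive multiple of (p - r)^2.\<close>

lemma quadratic_resultant_eq_0:
  assumes "p\<^sup>2 < 4 * q" and "quadratic_resultant p q r s = 0"
  shows "p = r \<and> q = s"
proof -
  have "(2 * (q - s) - p * (p - r))\<^sup>2 + (4 * q - p\<^sup>2) * (p - r)\<^sup>2 = 4 * quadratic_resultant p q r s"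
    by (simp add: quadratic_resultant_def power2_eq_square algebra_simps)
  moreover have "(4 * q - p\<^sup>2) * (p - r)\<^sup>2 \<ge> 0"
    using assms(1) by simp
  ultimately have "(2 * (q - s) - p * (p - r))\<^sup>2 = 0" and "(4 * q - p\<^sup>2) * (p - r)\<^sup>2 = 0"
    using assms(2) zero_le_power2[of "2 * (q - s) - p * (p - r)"] by linarith+
  then show ?thesis
    using assms(1) by auto
qed

text \<open>The seminvariants of f entering \<open>\<Delta>\<close> depend on the two factors only through the product T
  of their discriminants and the joint invariant N.\<close>
lemma quartic_Delta_quadratic_product:
  assumes qs: "q * s = 1"
  shows "quartic_Delta (p + r) (q + s + p * r) (p * s + r * q)
    = 27 * ((p\<^sup>2 - 4 * q) * (r\<^sup>2 - 4 * s)) * (quadratic_resultant p q r s)\<^sup>2"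
proof -
  define \<alpha> \<beta> \<gamma> where coeffs: "\<alpha> = p + r" "\<beta> = q + s + p * r" "\<gamma> = p * s + r * q"
  define T N where T: "T = (p\<^sup>2 - 4 * q) * (r\<^sup>2 - 4 * s)" and N: "N = 2 * q + 2 * s - p * r"
  define I J where I: "I = \<beta>\<^sup>2 - 3 * \<alpha> * \<gamma> + 12"
    and J: "J = 72 * \<beta> + 9 * \<alpha> * \<beta> * \<gamma> - 2 * \<beta> ^ 3 - 27 * \<alpha>\<^sup>2 - 27 * \<gamma>\<^sup>2"
  \<comment> \<open>With \<open>q * s\<close> inserted for 1 this is a polynomial identity in p, q,
    r, s; the same device serves for \<open>J\<close>.\<close>
  have "4 * (\<beta>\<^sup>2 - 3 * \<alpha> * \<gamma> + 12 * (q * s)) = N\<^sup>2 + 3 * T"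
    unfolding coeffs T N by (simp add: power2_eq_square algebra_simps)
  then have 4: "4 * I = N\<^sup>2 + 3 * T"
    by (simp add: I qs)
  have "4 * (72 * \<beta> * (q * s) + 9 * \<alpha> * \<beta> * \<gamma> - 2 * \<beta> ^ 3 - 27 * \<alpha>\<^sup>2 * (q * s) - 27 * \<gamma>\<^sup>2)
      = 9 * N * T - N ^ 3"
    unfolding coeffs T N by (simp add: power2_eq_square power3_eq_cube algebra_simps)
  then have 5: "4 * J = 9 * N * T - N ^ 3"
    by (simp add: J qs)
  have Res: "4 * quadratic_resultant p q r s = N\<^sup>2 - T"
    unfolding quadratic_resultant_def T N by (simp add: power2_eq_square algebra_simps)
  have "16 * (4 * I ^ 3 - J\<^sup>2) = (4 * I) ^ 3 - (4 * J)\<^sup>2"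
    by (simp add: power_mult_distrib)
  also have "\<dots> = 27 * T * (N\<^sup>2 - T)\<^sup>2"
    unfolding 4 5 by (simp add: power2_eq_square power3_eq_cube algebra_simps)
  also have "\<dots> = 16 * (27 * T * (quadratic_resultant p q r s)\<^sup>2)"
    unfolding Res[symmetric] by (simp add: power_mult_distrib)
  finally show ?thesis
    by (simp add: quartic_Delta_def coeffs[symmetric] I[symmetric] J[symmetric] T[symmetric])
qed

section \<open>The root conditions in terms of the factors\<close>

text \<open>Squaring removes the radicals. The bound \<beta> \<ge> -2 is contained in the first
  inequality, whose left side is nonnegative.\<close>

definition root_conditions :: "real \<Rightarrow> real \<Rightarrow> real \<Rightarrow> bool" where
  "root_conditions \<alpha> \<beta> \<gamma> \<longleftrightarrow>
    (\<alpha> - \<gamma>)\<^sup>2 \<le> 16 * (\<beta> + 2) \<and> (\<beta> \<le> 6 \<or> (\<alpha> + \<gamma>)\<^sup>2 \<le> 16 * (\<beta> - 2))"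

lemma abs_le_4_sqrt_iff:
  fixes x y :: real
  assumes "y \<ge> 0"
  shows "\<bar>x\<bar> \<le> 4 * sqrt y \<longleftrightarrow> x\<^sup>2 \<le> 16 * y"
  using abs_le_square_iff[of x "4 * sqrt y"] assms by (simp add: power_mult_distrib)

lemma root_conditions_iff:
  "root_conditions \<alpha> \<beta> \<gamma> \<longleftrightarrow> \<bar>\<alpha> - \<gamma>\<bar> \<le> 4 * sqrt (\<beta> + 2) \<and>
    ((- 2 \<le> \<beta> \<and> \<beta> \<le> 6) \<or> (\<beta> > 6 \<and> \<bar>\<alpha> + \<gamma>\<bar> \<le> 4 * sqrt (\<beta> - 2)))"
proof (cases "\<beta> \<ge> - 2")
  case True
  then show ?thesis
    using abs_le_4_sqrt_iff[of "\<beta> + 2" "\<alpha> - \<gamma>"] abs_le_4_sqrt_iff[of "\<beta> - 2" "\<alpha> + \<gamma>"]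
    by (auto simp: root_conditions_def)
next
  case False
  \<comment> \<open>Both sides are false here, whatever value \<open>sqrt\<close> takes at a
    negative argument.\<close>
  then have "16 * (\<beta> + 2) < 0"
    by simp
  also have "\<dots> \<le> (\<alpha> - \<gamma>)\<^sup>2"
    by simp
  finally show ?thesis
    using False by (auto simp: root_conditions_def)
qed

text \<open>Putting t = k x turns t^2 + p t + q into k^2 (x^2 + P x + 1), so the discriminant
  condition compares P^2 with 4; likewise with \<open>l\<close> and \<open>R\<close>.\<close>

lemma pos_normal_form:
  fixes p q r s :: real
  assumes qs: "q * s = 1" and q: "q > 0"
  obtains k l P R where "k > 0" "l > 0" "k * l = 1" "q = k\<^sup>2" "s = l\<^sup>2" "p = k * P" "r = l * R"
proof
  have "s > 0"
    using qs q by (metis zero_less_mult_pos zero_less_one)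
  then show "sqrt q > 0" "sqrt s > 0" "sqrt q * sqrt s = 1" "q = (sqrt q)\<^sup>2" "s = (sqrt s)\<^sup>2"
    "p = sqrt q * (p / sqrt q)" "r = sqrt s * (r / sqrt s)"
    using q qs by (simp_all add: real_sqrt_mult[symmetric])
qed

lemma disc_normal_form:
  fixes k P :: real
  assumes "k > 0"
  shows "(k * P)\<^sup>2 \<le> 4 * k\<^sup>2 \<longleftrightarrow> P\<^sup>2 \<le> 4" and "4 * k\<^sup>2 \<le> (k * P)\<^sup>2 \<longleftrightarrow> 4 \<le> P\<^sup>2"
  using assms by (simp_all add: power_mult_distrib)

text \<open>Since k l = 1, k^2 + l^2 = u^2 + 2 and (k + l)^2 = u^2 + 4, so only u^2, P and R
  remain.\<close>

lemma root_conditions_normal_form: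
  fixes k l P R :: real
  assumes kl: "k * l = 1"
  defines "u \<equiv> k - l"
  shows "root_conditions (k * P + l * R) (k\<^sup>2 + l\<^sup>2 + k * P * (l * R)) (k * P * l\<^sup>2 + l * R * k\<^sup>2)
    \<longleftrightarrow> u\<^sup>2 * (P - R)\<^sup>2 \<le> 16 * (u\<^sup>2 + 4 + P * R) \<and>
      (u\<^sup>2 + P * R \<le> 4 \<or> (u\<^sup>2 + 4) * (P + R)\<^sup>2 \<le> 16 * (u\<^sup>2 + P * R))"
proof -
  have \<beta>: "k\<^sup>2 + l\<^sup>2 + k * P * (l * R) = u\<^sup>2 + 2 + P * R"
    unfolding u_def using kl by algebra
  have 1: "(k * P + l * R - (k * P * l\<^sup>2 + l * R * k\<^sup>2))\<^sup>2 = u\<^sup>2 * (P - R)\<^sup>2"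
    unfolding u_def using kl by algebra
  have 2: "(k * P + l * R + (k * P * l\<^sup>2 + l * R * k\<^sup>2))\<^sup>2 = (u\<^sup>2 + 4) * (P + R)\<^sup>2"
    unfolding u_def using kl by algebra
  show ?thesis
    unfolding root_conditions_def 1 2 \<beta> by (auto simp: algebra_simps)
qed

text \<open>The last inequality is affine in u^2, and as (P + R)^2 \<le> 16 it only gets weaker when
  u^2 grows. It therefore suffices to have it at u^2 = 4 - P R, where it reads (P + R)^2 (8 - P R)
  \<le> 64.\<close>

lemma root_conditions_if_no_simple_roots:
  fixes u P R :: real
  assumes P: "P\<^sup>2 \<le> 4" and R: "R\<^sup>2 \<le> 4"
  shows "u\<^sup>2 * (P - R)\<^sup>2 \<le> 16 * (u\<^sup>2 + 4 + P * R)"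
    and "u\<^sup>2 + P * R \<le> 4 \<or> (u\<^sup>2 + 4) * (P + R)\<^sup>2 \<le> 16 * (u\<^sup>2 + P * R)"
proof -
  have bounds: "\<bar>P\<bar> \<le> 2" "\<bar>R\<bar> \<le> 2"
    using P R abs_le_square_iff[of P 2] abs_le_square_iff[of R 2] by simp_all
  have "\<bar>P * R\<bar> \<le> 2 * 2"
    unfolding abs_mult using bounds by (intro mult_mono) auto
  then have PR: "\<bar>P * R\<bar> \<le> 4"
    by simp
  have "(P - R)\<^sup>2 \<le> 4\<^sup>2"
    using bounds by (intro power2_le_iff_abs_le[THEN iffD2]) auto
  then have "u\<^sup>2 * (P - R)\<^sup>2 \<le> u\<^sup>2 * 4\<^sup>2"
    by (intro mult_left_mono) auto
  then show "u\<^sup>2 * (P - R)\<^sup>2 \<le> 16 * (u\<^sup>2 + 4 + P * R)"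
    using PR by (simp add: algebra_simps)
  have "(P + R)\<^sup>2 \<le> 4\<^sup>2"
    using bounds by (intro power2_le_iff_abs_le[THEN iffD2]) auto
  then have S: "(P + R)\<^sup>2 \<le> 16"
    by simp
  have "(2 - P) * (2 - R) \<ge> 0" "(2 + P) * (2 + R) \<ge> 0"
    using bounds by simp_all
  then have "\<bar>2 * (P + R)\<bar> \<le> \<bar>4 + P * R\<bar>"
    by (simp add: algebra_simps abs_le_iff)
  then have "(2 * (P + R))\<^sup>2 \<le> (4 + P * R)\<^sup>2"
    by (simp only: abs_le_square_iff)
  then have "4 * (P + R)\<^sup>2 \<le> (4 + P * R)\<^sup>2"
    using power_mult_distrib[of 2 "P + R" 2] by simp
  \<comment> \<open>With x = P R, the cubic (4 + x)^2 (8 - x) has maximum 256 on [-4, 4], attained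
    at x = 4.\<close>
  then have "4 * (P + R)\<^sup>2 * (8 - P * R) \<le> (4 + P * R)\<^sup>2 * (8 - P * R)"
    using PR by (intro mult_right_mono) auto
  also have "\<dots> = 256 - (P * R - 4)\<^sup>2 * (P * R + 8)"
    by (simp add: power2_eq_square algebra_simps)
  also have "\<dots> \<le> 256"
    using PR by simp
  finally have key: "(P + R)\<^sup>2 * (8 - P * R) \<le> 64"
    by simp
  show "u\<^sup>2 + P * R \<le> 4 \<or> (u\<^sup>2 + 4) * (P + R)\<^sup>2 \<le> 16 * (u\<^sup>2 + P * R)"
  proof (cases "u\<^sup>2 + P * R \<le> 4")
    case False
    then have "(4 - P * R) * (16 - (P + R)\<^sup>2) \<le> u\<^sup>2 * (16 - (P + R)\<^sup>2)"
      using S by (intro mult_right_mono) auto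
    with key have "(u\<^sup>2 + 4) * (P + R)\<^sup>2 \<le> 16 * (u\<^sup>2 + P * R)"
      by (simp add: algebra_simps)
    then show ?thesis ..
  qed simp
qed

text \<open>Here |P R| > 4. If P R < -4, then (P - R)^2 > 16 contradicts the first inequality; if P
  R > 4, only the second alternative is left, and it bounds a sum of nonnegative terms by 0.\<close>

lemma root_conditions_real_roots:
  fixes u P R :: real
  assumes P: "4 < P\<^sup>2" and R: "4 \<le> R\<^sup>2"
    and 1: "u\<^sup>2 * (P - R)\<^sup>2 \<le> 16 * (u\<^sup>2 + 4 + P * R)"
    and 2: "u\<^sup>2 + P * R \<le> 4 \<or> (u\<^sup>2 + 4) * (P + R)\<^sup>2 \<le> 16 * (u\<^sup>2 + P * R)"
  shows "u = 0 \<and> P = R"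
proof -
  have "4 * 4 < P\<^sup>2 * R\<^sup>2"
    using P R by (intro mult_less_le_imp_less) auto
  then have "4\<^sup>2 < (P * R)\<^sup>2"
    by (simp add: power_mult_distrib)
  then have "4 < \<bar>P * R\<bar>"
    using power2_less_imp_less[of 4 "\<bar>P * R\<bar>"] by simp
  then consider "P * R < - 4" | "P * R > 4"
    by linarith
  then show ?thesis
  proof cases
    case 1
    have "(P - R)\<^sup>2 = P\<^sup>2 + R\<^sup>2 - 2 * (P * R)"
      by (simp add: power2_eq_square algebra_simps)
    then have "u\<^sup>2 * 16 \<le> u\<^sup>2 * (P - R)\<^sup>2"
      using P R 1 by (intro mult_left_mono) auto
    with assms(3) 1 show ?thesis
      by simp
  next
    case 2
    have S: "(P + R)\<^sup>2 = P\<^sup>2 + R\<^sup>2 + 2 * (P * R)"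
      by (simp add: power2_eq_square algebra_simps)
    have "(u\<^sup>2 + 4) * (P + R)\<^sup>2 \<le> 16 * (u\<^sup>2 + P * R)"
      using assms(4) 2 zero_le_power2[of u] by linarith
    then have sum: "u\<^sup>2 * ((P + R)\<^sup>2 - 16) + 4 * (P - R)\<^sup>2 \<le> 0"
      by (simp add: power2_eq_square algebra_simps)
    have "u\<^sup>2 * ((P + R)\<^sup>2 - 16) \<ge> 0"
      using P R 2 S by simp
    then have "u\<^sup>2 * ((P + R)\<^sup>2 - 16) = 0" and "(P - R)\<^sup>2 = 0"
      using sum zero_le_power2[of "P - R"] by linarith+
    moreover have "(P + R)\<^sup>2 - 16 \<noteq> 0"
      using P R 2 S by simp
    ultimately show ?thesis
      by simp
  qed
qed

text \<open>Normalising -q and -s exchanges the roles of sum and difference: \<alpha> - \<gamma>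
  becomes (k + l)(P + R). The first root condition alone then bounds a sum of squares by 0.\<close>

lemma root_conditions_neg:
  fixes p q r s :: real
  assumes qs: "q * s = 1" and q: "q < 0"
    and rc: "root_conditions (p + r) (q + s + p * r) (p * s + r * q)"
  shows "p = r \<and> q = s"
proof -
  have "(- q) * (- s) = 1" and "- q > 0"
    using qs q by simp_all
  then obtain k l P R where kl: "k > 0" "l > 0" "k * l = 1" and
    eqs: "- q = k\<^sup>2" "- s = l\<^sup>2" "p = k * P" "r = l * R"
    by (rule pos_normal_form)
  have q_s: "q = - k\<^sup>2" "s = - l\<^sup>2"
    using eqs by simp_all
  define u where "u = k - l"
  have 1: "q + s + p * r + 2 = P * R - u\<^sup>2"
    unfolding q_s eqs u_def using kl(3) by algebra
  have 2: "(p + r - (p * s + r * q))\<^sup>2 = (u\<^sup>2 + 4) * (P + R)\<^sup>2"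
    unfolding q_s eqs u_def using kl(3) by algebra
  have "(u\<^sup>2 + 4) * (P + R)\<^sup>2 \<le> 16 * (P * R - u\<^sup>2)"
    using rc unfolding root_conditions_def 1 2 by simp
  then have "u\<^sup>2 * (P + R)\<^sup>2 + 4 * (P - R)\<^sup>2 + 16 * u\<^sup>2 \<le> 0"
    by (simp add: power2_eq_square algebra_simps)
  moreover have "u\<^sup>2 * (P + R)\<^sup>2 \<ge> 0"
    by simp
  ultimately have "u\<^sup>2 = 0" and "(P - R)\<^sup>2 = 0"
    using zero_le_power2[of u] zero_le_power2[of "P - R"] by linarith+
  then show ?thesis
    by (simp add: q_s eqs u_def)
qed

lemma root_conditions_pos_real_roots:
  fixes p q r s :: real
  assumes qs: "q * s = 1" and q: "q > 0" and disc: "4 * q < p\<^sup>2" "4 * s \<le> r\<^sup>2"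
    and rc: "root_conditions (p + r) (q + s + p * r) (p * s + r * q)"
  shows "p = r \<and> q = s"
proof -
  obtain k l P R where kl: "k > 0" "l > 0" "k * l = 1" and
    eqs: "q = k\<^sup>2" "s = l\<^sup>2" "p = k * P" "r = l * R"
    using qs q by (rule pos_normal_form)
  have "4 < P\<^sup>2" "4 \<le> R\<^sup>2"
    using disc disc_normal_form[OF kl(1), of P] disc_normal_form[OF kl(2), of R]
    unfolding eqs by linarith+
  then have "k - l = 0 \<and> P = R"
    using rc unfolding eqs root_conditions_normal_form[OF kl(3)]
    by (intro root_conditions_real_roots) auto
  then show ?thesis
    by (simp add: eqs)
qed

section \<open>The criteria for nonnegativity and positivity\<close>

text \<open>For the converse, the root conditions leave, for distinct factors, only q > 0 and either
  no positive discriminant or discriminants of strictly opposite signs. The latter would make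
  \<Delta> negative.\<close>

lemma nonneg_factors_iff:
  fixes p q r s :: real
  assumes qs: "q * s = 1"
  defines "\<Delta> \<equiv> quartic_Delta (p + r) (q + s + p * r) (p * s + r * q)"
  shows "(p\<^sup>2 \<le> 4 * q \<and> r\<^sup>2 \<le> 4 * s) \<or> (p = r \<and> q = s) \<longleftrightarrow>
    \<Delta> \<ge> 0 \<and> root_conditions (p + r) (q + s + p * r) (p * s + r * q)" (is "?L \<longleftrightarrow> ?R")
proof
  have \<Delta>: "\<Delta> = 27 * ((p\<^sup>2 - 4 * q) * (r\<^sup>2 - 4 * s)) * (quadratic_resultant p q r s)\<^sup>2"
    unfolding \<Delta>_def using qs by (rule quartic_Delta_quadratic_product)
  have q0: "q \<noteq> 0"
    using qs by auto
  {
    assume ?L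
    then consider (disc) "p\<^sup>2 \<le> 4 * q" "r\<^sup>2 \<le> 4 * s" | (eq) "p = r" "q = s"
      by blast
    then show ?R
    proof cases
      case disc
      have "q > 0"
        using disc(1) q0 zero_le_power2[of p] by linarith
      with qs obtain k l P R where kl: "k > 0" "l > 0" "k * l = 1" and
        eqs: "q = k\<^sup>2" "s = l\<^sup>2" "p = k * P" "r = l * R"
        by (rule pos_normal_form)
      have "P\<^sup>2 \<le> 4" "R\<^sup>2 \<le> 4"
        using disc disc_normal_form(1) kl unfolding eqs by blast+
      then have "root_conditions (p + r) (q + s + p * r) (p * s + r * q)"
        unfolding eqs root_conditions_normal_form[OF kl(3)]
        using root_conditions_if_no_simple_roots by blast
      moreover have "\<Delta> \<ge> 0"
        unfolding \<Delta> using disc by (simp add: mult_nonpos_nonpos)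
      ultimately show ?R
        by blast
    next
      case eq
      have "q = 1 \<or> q = - 1"
        using qs eq by (simp add: power2_eq_1_iff[symmetric] power2_eq_square)
      \<comment> \<open>For q = 1 the inequality for \<alpha> + \<gamma> is an equality, for q = -1
        the one for \<alpha> - \<gamma>.\<close>
      then have "root_conditions (p + r) (q + s + p * r) (p * s + r * q)"
        using eq by (auto simp: root_conditions_def power2_eq_square)
      moreover have "\<Delta> = 0"
        unfolding \<Delta> using eq by (simp add: quadratic_resultant_def)
      ultimately show ?R
        by simp
    qed
  }
  assume ?R
  show ?L
  proof (cases "q > 0")
    case False
    then show ?L
      using root_conditions_neg[OF qs] q0 \<open>?R\<close> by fastforce
  next
    case True
    then have "s > 0"
      using qs by (metis zero_less_mult_pos zero_less_one)
    have "s * q = 1"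
      using qs by (simp add: mult.commute)
    show ?L
    proof (rule ccontr)
      assume neg: "\<not> ?L"
      \<comment> \<open>Exchanging the factors leaves the coefficients unchanged, so the case of
        real roots applies in both orders.\<close>
      have rc': "root_conditions (r + p) (s + q + r * p) (r * q + p * s)"
        using \<open>?R\<close> by (simp add: algebra_simps)
      have "\<not> (4 * q < p\<^sup>2 \<and> 4 * s \<le> r\<^sup>2)" "\<not> (4 * s < r\<^sup>2 \<and> 4 * q \<le> p\<^sup>2)"
        using root_conditions_pos_real_roots[OF qs True]
          root_conditions_pos_real_roots[OF \<open>s * q = 1\<close> \<open>s > 0\<close> _ _ rc'] \<open>?R\<close> neg by blast+
      then consider "4 * q < p\<^sup>2" "r\<^sup>2 < 4 * s" | "4 * s < r\<^sup>2" "p\<^sup>2 < 4 * q"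
        using neg by (metis not_le)
      then have "(p\<^sup>2 - 4 * q) * (r\<^sup>2 - 4 * s) < 0 \<and> quadratic_resultant p q r s \<noteq> 0"
      proof cases
        case 1
        then show ?thesis
          using neg quadratic_resultant_eq_0[of r s p q]
          by (auto simp: quadratic_resultant_commute[of p] intro: mult_pos_neg)
      next
        case 2
        then show ?thesis
          using neg quadratic_resultant_eq_0[of p q r s] by (auto intro: mult_neg_pos)
      qed
      then have "\<Delta> < 0"
        unfolding \<Delta> by (simp add: mult_less_0_iff)
      with \<open>?R\<close> show False
        by simp
    qed
  qed
qed

theorem theorem4p3:
  fixes a b c d e \<alpha> \<beta> \<gamma> :: real
    and g f :: "real poly"
  assumes g: "g = [:e, d, c, b, a:]"
    and a_pos: "a > 0"
    and e_pos: "e > 0"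
    and \<alpha>: "\<alpha> = b * a powr (- 3 / 4) * e powr (- 1 / 4)"
    and \<beta>: "\<beta> = c * a powr (- 1 / 2) * e powr (- 1 / 2)"
    and \<gamma>: "\<gamma> = d * a powr (- 1 / 4) * e powr (- 3 / 4)"
    and f: "f = [:1, \<gamma>, \<beta>, \<alpha>, 1:]"
  shows "((\<forall>t. poly f t \<ge> 0) \<longleftrightarrow>
            quartic_Delta \<alpha> \<beta> \<gamma> \<ge> 0 \<and> \<bar>\<alpha> - \<gamma>\<bar> \<le> 4 * sqrt (\<beta> + 2) \<and>
            ((- 2 \<le> \<beta> \<and> \<beta> \<le> 6) \<or> (\<beta> > 6 \<and> \<bar>\<alpha> + \<gamma>\<bar> \<le> 4 * sqrt (\<beta> - 2))))
       \<and> ((\<forall>t. poly f t > 0) \<longleftrightarrow>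
            (quartic_Delta \<alpha> \<beta> \<gamma> = 0 \<and> \<alpha> = \<gamma> \<and> \<alpha>^2 + 8 = 4 * \<beta> \<and> 4 * \<beta> < 24)
          \<or> (quartic_Delta \<alpha> \<beta> \<gamma> > 0 \<and> \<bar>\<alpha> - \<gamma>\<bar> \<le> 4 * sqrt (\<beta> + 2) \<and>
             ((- 2 \<le> \<beta> \<and> \<beta> \<le> 6) \<or> (\<beta> > 6 \<and> \<bar>\<alpha> + \<gamma>\<bar> \<le> 4 * sqrt (\<beta> - 2)))))"
proof -
  obtain p q r s where coeffs: "\<alpha> = p + r" "\<beta> = q + s + p * r" "\<gamma> = p * s + r * q" "q * s = 1"
    using quartic_factor[of \<alpha> \<beta> \<gamma> 1] by metis
  have prod: "poly f t = (t\<^sup>2 + p * t + q) * (t\<^sup>2 + r * t + s)" for t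
  proof -
    have "poly f t = q * s + t * (\<gamma> + t * (\<beta> + t * (\<alpha> + t)))"
      by (simp add: f coeffs(4))
    then show ?thesis
      unfolding coeffs(1-3) by (simp add: power2_eq_square algebra_simps)
  qed
  define rc where "rc \<longleftrightarrow> root_conditions \<alpha> \<beta> \<gamma>"
  define \<Delta> where "\<Delta> = quartic_Delta \<alpha> \<beta> \<gamma>"
  define A where "A \<longleftrightarrow> \<Delta> = 0 \<and> \<alpha> = \<gamma> \<and> \<alpha>\<^sup>2 + 8 = 4 * \<beta> \<and> 4 * \<beta> < 24"
  have \<Delta>: "\<Delta> = 27 * ((p\<^sup>2 - 4 * q) * (r\<^sup>2 - 4 * s)) * (quadratic_resultant p q r s)\<^sup>2"
    unfolding \<Delta>_def coeffs(1-3) using coeffs(4) by (rule quartic_Delta_quadratic_product)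
  have factors_iff: "(p\<^sup>2 \<le> 4 * q \<and> r\<^sup>2 \<le> 4 * s) \<or> (p = r \<and> q = s) \<longleftrightarrow> \<Delta> \<ge> 0 \<and> rc"
    unfolding rc_def \<Delta>_def coeffs(1-3) using coeffs(4) by (rule nonneg_factors_iff)
  have nonneg: "(\<forall>t. poly f t \<ge> 0) \<longleftrightarrow> \<Delta> \<ge> 0 \<and> rc"
    unfolding prod quadratic_product_nonneg_iff by (rule factors_iff)
  have pos: "(\<forall>t. poly f t > 0) \<longleftrightarrow> p\<^sup>2 < 4 * q \<and> r\<^sup>2 < 4 * s"
    unfolding prod by (rule quadratic_product_pos_iff)
  have "(\<forall>t. poly f t > 0) \<longleftrightarrow> A \<or> (\<Delta> > 0 \<and> rc)"
  proof
    assume "\<forall>t. poly f t > 0"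
    with pos have disc: "p\<^sup>2 < 4 * q" "r\<^sup>2 < 4 * s"
      by simp_all
    with factors_iff have "\<Delta> \<ge> 0 \<and> rc"
      by simp
    \<comment> \<open>With both discriminants negative, \<Delta> vanishes only through the
      resultant. So f is the square of a quadratic without real roots, which is case (A).\<close>
    moreover have A if "\<Delta> = 0"
    proof -
      have "quadratic_resultant p q r s = 0"
        using that disc by (simp add: \<Delta>)
      with disc(1) have eq: "p = r" "q = s"
        using quadratic_resultant_eq_0 by blast+
      have "q > 0"
        using disc(1) zero_le_power2[of p] by linarith
      then have "q = 1"
        using coeffs(4) eq by (metis power2_eq_1_iff power2_eq_square less_asym
            neg_less_0_iff_less zero_less_one)
      then show A
        using that disc eq unfolding A_def coeffs(1-3)
        by (auto simp: power2_eq_square algebra_simps)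
    qed
    ultimately show "A \<or> (\<Delta> > 0 \<and> rc)"
      by fastforce
  next
    assume "A \<or> (\<Delta> > 0 \<and> rc)"
    then show "\<forall>t. poly f t > 0"
    proof
      assume A
      then have eqs: "\<gamma> = \<alpha>" "\<beta> = 2 + (\<alpha> / 2)\<^sup>2" and "(\<alpha> / 2)\<^sup>2 < 4 * 1"
        by (auto simp: A_def power_divide)
      have "poly f t = (t\<^sup>2 + \<alpha> / 2 * t + 1)\<^sup>2" for t
        unfolding f eqs by (simp add: power2_eq_square field_simps)
      moreover have "t\<^sup>2 + \<alpha> / 2 * t + 1 > 0" for t
        using \<open>(\<alpha> / 2)\<^sup>2 < 4 * 1\<close> by (rule quadratic_pos)
      ultimately show ?thesis
        by (metis zero_less_power)
    next
      assume "\<Delta> > 0 \<and> rc"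
      \<comment> \<open>A positive \<Delta> excludes equal factors and zero discriminants, so the
        weak inequalities for the discriminants become strict.\<close>
      then have "\<not> (p = r \<and> q = s)" and "p\<^sup>2 \<noteq> 4 * q" and "r\<^sup>2 \<noteq> 4 * s"
        by (auto simp: \<Delta> quadratic_resultant_def)
      then show ?thesis
        using factors_iff \<open>\<Delta> > 0 \<and> rc\<close> unfolding pos by auto
    qed
  qed
  with nonneg show ?thesis
    unfolding rc_def root_conditions_iff A_def \<Delta>_def by blast
qed

end
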